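(* Let $\mathbb{K}$ be an algebraically closed field of arbitrary characteristic, and let $m,n\in\mathbb{N}$ with $m,n\geq 2$. Let $M_{m,n}^2\subset\mathbb{K}^{mn}$ be the 2-generic determinantal variety, i.e. the set of $(m\times n)$-matrices over $\mathbb{K}$ of rank less than $2$. Let $e_1,\ldots,e_{m+n-1}$ be the canonical basis of $\mathbb{Z}^{m+n-1}$ and let $\Gamma\subset\mathbb{Z}^{m+n-1}$ be the semigroup generated by $$\mathcal{A}=\{e_1,\ldots,e_{m+n-1}\}\cup\{-e_1+e_i+e_{m+j-1}\mid 2\leq i\leq m,\ 2\leq j\leq n\}.$$ Then $M_{m,n}^2=X_\Gamma$, where $X_\Gamma\subseteq\mathbb{K}^{mn}$ is the toric variety defined by $\Gamma$ (with the generators of $\Gamma$ matched with the coordinates $x_{ij}$ of $\mathbb{K}^{mn}$ as specified in the context).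
   Context: Semigroups are generated under addition with non-negative integer coefficients (so they contain $0$). Generic determinantal variety: let $x_{ij}$ ($1\leq i\leq m$, $1\leq j\leq n$) be indeterminates and let $J_2\subset\mathbb{K}[x_{ij}\mid 1\leq i\leq m,1\leq j\leq n]$ be the ideal generated by all $(2\times 2)$-minors of the matrix $(x_{ij})$. Then $M_{m,n}^2=\mathbf{V}(J_2)\subset\mathbb{K}^{mn}$ (common zero set), i.e. the set of $m\times n$ matrices of rank less than $2$. Toric variety: for a semigroup $\Gamma\subseteq\mathbb{Z}^d$ generated by a finite set of vectors $\{\gamma_1,\ldots,\gamma_N\}$, let $\pi_\Gamma:\mathbb{K}[x_1,\ldots,x_N]\to\mathbb{K}[t_1^{\pm},\ldots,t_d^{\pm}]$ be the $\mathbb{K}$-algebra homomorphism $x_i\mapsto t^{\gamma_i}$, and $I_\Gamma=\ker\pi_\Gamma$. The toric variety defined by $\Gamma$ is $X_\Gamma=\mathbf{V}(I_\Gamma)\subseteq\mathbb{K}^N$. Matching of coordinates: here $d=m+n-1$, $N=mn$, and the indeterminate $x_{ij}$ is sent to $t^{\gamma_{ij}}$, where $\gamma_{i1}=e_i$ for $1\leq i\leq m$; $\gamma_{1j}=e_{m+j-1}$ for $2\leq j\leq n$; $\gamma_{ij}=-e_1+e_i+e_{m+j-1}$ for $2\leq i\leq m$, $2\leq j\leq n$. These $mn$ vectors are exactly the elements of $\mathcal{A}$. *)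

theory Defs
  imports
    "HOL-Library.Poly_Mapping"
    "HOL-Library.FuncSet"
    "HOL-Computational_Algebra.Polynomial"
    "HOL-Algebra.Ideal"
begin

section \<open>Polynomials in several indeterminates\<close>

text \<open>
  A polynomial over \<open>'k\<close> in indeterminates indexed by \<open>'i\<close> is a finitely supported map from
  exponents (finitely supported maps from \<open>'i\<close> to the naturals) to \<open>'k\<close>.  Replacing
  the naturals by the integers yields Laurent polynomials.  The ring operations are the
  convolution operations of \<^theory>\<open>HOL-Library.Poly_Mapping\<close>.
\<close>

type_synonym ('i, 'k) mvpoly = "('i \<Rightarrow>\<^sub>0 nat) \<Rightarrow>\<^sub>0 'k"
type_synonym ('i, 'k) laurent = "('i \<Rightarrow>\<^sub>0 int) \<Rightarrow>\<^sub>0 'k"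

definition indet :: "'i \<Rightarrow> ('i, 'k::comm_ring_1) mvpoly"
  where "indet i = Poly_Mapping.single (Poly_Mapping.single i 1) 1"

definition vars :: "('i, 'k::zero) mvpoly \<Rightarrow> 'i set"
  where "vars p = (\<Union>a\<in>Poly_Mapping.keys p. Poly_Mapping.keys a)"

text \<open>The ring \<open>\<K>[x\<^sub>i | i \<in> I]\<close>, as a subring of all polynomials over \<open>'k\<close>.\<close>

definition poly_ring :: "'i set \<Rightarrow> ('i, 'k::comm_ring_1) mvpoly ring"
  where "poly_ring I =
    \<lparr>carrier = {p. vars p \<subseteq> I}, monoid.mult = (*), one = 1, zero = 0, add = (+)\<rparr>"

text \<open>
  The substitution \<open>x\<^sub>i \<mapsto> f i\<close> into a commutative ring, where the
  scalars are mapped by \<open>c\<close>.  If \<open>c\<close> is a ring homomorphism, this is the unique ring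
  homomorphism extending \<open>c\<close> with these values; see the lemmas below.
\<close>

definition poly_subst ::
    "('k::comm_ring_1 \<Rightarrow> 'r::comm_ring_1) \<Rightarrow> ('i \<Rightarrow> 'r) \<Rightarrow> ('i, 'k) mvpoly \<Rightarrow> 'r"
  where "poly_subst c f p =
    (\<Sum>a\<in>Poly_Mapping.keys p.
       c (Poly_Mapping.lookup p a) *
       (\<Prod>i\<in>Poly_Mapping.keys a. f i ^ Poly_Mapping.lookup a i))"

definition poly_eval :: "('i \<Rightarrow> 'k::comm_ring_1) \<Rightarrow> ('i, 'k) mvpoly \<Rightarrow> 'k"
  where "poly_eval x p = poly_subst (\<lambda>a. a) x p"

text \<open>The points of \<open>\<K>\<^sup>I\<close> are the extensional functions on \<open>I\<close>.\<close>

definition zero_set :: "'i set \<Rightarrow> ('i, 'k::comm_ring_1) mvpoly set \<Rightarrow> ('i \<Rightarrow> 'k) set"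
  where "zero_set I J = {x \<in> I \<rightarrow>\<^sub>E UNIV. \<forall>p\<in>J. poly_eval x p = 0}"

section \<open>The 2-generic determinantal variety\<close>

definition positions :: "nat \<Rightarrow> nat \<Rightarrow> (nat \<times> nat) set"
  where "positions m n = {1..m} \<times> {1..n}"

definition two_minors :: "nat \<Rightarrow> nat \<Rightarrow> (nat \<times> nat, 'k::comm_ring_1) mvpoly set"
  where "two_minors m n =
    {indet (i, j) * indet (k, l) - indet (i, l) * indet (k, j) | i j k l.
       1 \<le> i \<and> i < k \<and> k \<le> m \<and> 1 \<le> j \<and> j < l \<and> l \<le> n}"

definition determinantal_ideal :: "nat \<Rightarrow> nat \<Rightarrow> (nat \<times> nat, 'k::comm_ring_1) mvpoly set"
  where "determinantal_ideal m n = genideal (poly_ring (positions m n)) (two_minors m n)"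

definition determinantal_variety :: "nat \<Rightarrow> nat \<Rightarrow> (nat \<times> nat \<Rightarrow> 'k::comm_ring_1) set"
  where "determinantal_variety m n = zero_set (positions m n) (determinantal_ideal m n)"

section \<open>Toric varieties\<close>

text \<open>
  The lattice \<open>\<int>\<^sup>d\<close> consists of the finitely supported integer vectors with support
  in \<open>{1..d}\<close>.
\<close>

definition int_lattice :: "nat \<Rightarrow> (nat \<Rightarrow>\<^sub>0 int) set"
  where "int_lattice d = {v. Poly_Mapping.keys v \<subseteq> {1..d}}"

definition unit_vec :: "nat \<Rightarrow> nat \<Rightarrow>\<^sub>0 int"
  where "unit_vec i = Poly_Mapping.single i 1"

definition semigroup_generated :: "(nat \<Rightarrow>\<^sub>0 int) set \<Rightarrow> (nat \<Rightarrow>\<^sub>0 int) set"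
  where "semigroup_generated A =
    {\<Sum>v\<in>F. frag_cmul (int (c v)) v | F c. finite F \<and> F \<subseteq> A}"

definition laurent_monom :: "('i \<Rightarrow>\<^sub>0 int) \<Rightarrow> ('i, 'k::comm_ring_1) laurent"
  where "laurent_monom v = Poly_Mapping.single v 1"

text \<open>
  A toric variety is presented by a finite family \<open>\<gamma>\<close> of generators of the semigroup,
  indexed by the set \<open>I\<close> of coordinates.
\<close>

definition toric_hom ::
    "('i \<Rightarrow> nat \<Rightarrow>\<^sub>0 int) \<Rightarrow> ('i, 'k::comm_ring_1) mvpoly \<Rightarrow> (nat, 'k) laurent"
  where "toric_hom \<gamma> = poly_subst (Poly_Mapping.single 0) (\<lambda>i. laurent_monom (\<gamma> i))"

definition toric_ideal ::
    "'i set \<Rightarrow> ('i \<Rightarrow> nat \<Rightarrow>\<^sub>0 int) \<Rightarrow> ('i, 'k::comm_ring_1) mvpoly set"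
  where "toric_ideal I \<gamma> = {p \<in> carrier (poly_ring I). toric_hom \<gamma> p = 0}"

definition toric_variety ::
    "'i set \<Rightarrow> ('i \<Rightarrow> nat \<Rightarrow>\<^sub>0 int) \<Rightarrow> ('i \<Rightarrow> 'k::comm_ring_1) set"
  where "toric_variety I \<gamma> = zero_set I (toric_ideal I \<gamma>)"

section \<open>The generators attached to the determinantal variety\<close>

definition generators :: "nat \<Rightarrow> nat \<Rightarrow> (nat \<Rightarrow>\<^sub>0 int) set"
  where "generators m n =
    {unit_vec i | i. 1 \<le> i \<and> i \<le> m + n - 1} \<union>
    {- unit_vec 1 + unit_vec i + unit_vec (m + j - 1) | i j.
       2 \<le> i \<and> i \<le> m \<and> 2 \<le> j \<and> j \<le> n}"

text \<open>The generator matched with the coordinate \<open>x\<^sub>i\<^sub>j\<close>.\<close>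

definition generator :: "nat \<Rightarrow> nat \<times> nat \<Rightarrow> (nat \<Rightarrow>\<^sub>0 int)"
  where "generator m = (\<lambda>(i, j).
    if j = 1 then unit_vec i
    else if i = 1 then unit_vec (m + j - 1)
    else - unit_vec 1 + unit_vec i + unit_vec (m + j - 1))"

section \<open>Basic properties of the definitions\<close>

lemma vars_add: "vars (p + q) \<subseteq> vars p \<union> vars q"
  using Poly_Mapping.keys_add[of p q] by (auto simp: vars_def)

lemma vars_mult: "vars (p * q) \<subseteq> vars p \<union> vars q"
proof
  fix i assume "i \<in> vars (p * q)"
  then obtain a where a: "a \<in> Poly_Mapping.keys (p * q)" "i \<in> Poly_Mapping.keys a"
    by (auto simp: vars_def)
  from a(1) obtain b c where bc: "b \<in> Poly_Mapping.keys p" "c \<in> Poly_Mapping.keys q" "a = b + c"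
    using keys_mult[of p q] by auto
  with a(2) have "i \<in> Poly_Mapping.keys b \<union> Poly_Mapping.keys c"
    using Poly_Mapping.keys_add[of b c] by auto
  with bc show "i \<in> vars p \<union> vars q" by (auto simp: vars_def)
qed

lemma vars_uminus: "vars (- p) = vars (p :: ('i, 'k::comm_ring_1) mvpoly)"
  by (simp add: vars_def in_keys_iff keys_def)

lemma vars_zero: "vars 0 = {}" and vars_one: "vars (1 :: ('i, 'k::comm_ring_1) mvpoly) = {}"
  by (simp_all add: vars_def)

lemma cring_poly_ring: "cring (poly_ring I :: ('i, 'k::comm_ring_1) mvpoly ring)"
proof (rule cringI)
  show "abelian_group (poly_ring I :: ('i, 'k) mvpoly ring)"
  proof (rule abelian_groupI)
    fix p :: "('i, 'k) mvpoly" assume "p \<in> carrier (poly_ring I)"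
    then have "- p \<in> carrier (poly_ring I)" by (simp add: poly_ring_def vars_uminus)
    then show "\<exists>q\<in>carrier (poly_ring I). q \<oplus>\<^bsub>poly_ring I\<^esub> p = \<zero>\<^bsub>poly_ring I\<^esub>"
      by (intro bexI[of _ "- p"]) (simp_all add: poly_ring_def)
  qed (use vars_add in \<open>force simp: poly_ring_def vars_zero algebra_simps\<close>)+
  show "Group.comm_monoid (poly_ring I :: ('i, 'k) mvpoly ring)"
    by (rule comm_monoidI)
      (use vars_mult in \<open>force simp: poly_ring_def vars_one algebra_simps\<close>)+
qed (simp add: poly_ring_def algebra_simps)

lemma two_minors_carrier: "two_minors m n \<subseteq> carrier (poly_ring (positions m n))"
proof -
  have X: "vars (indet q :: ('i, 'k::comm_ring_1) mvpoly) \<subseteq> {q}" for q :: 'i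
    by (simp add: indet_def vars_def)
  have D: "vars (p - q) \<subseteq> vars p \<union> vars q" for p q :: "('i, 'k::comm_ring_1) mvpoly"
    using vars_add[of p "- q"] by (simp add: vars_uminus)
  show ?thesis
    unfolding two_minors_def poly_ring_def positions_def
    by clarsimp (drule subsetD[OF D], use X vars_mult in fastforce)
qed

definition monom_subst :: "('i \<Rightarrow> 'r::comm_ring_1) \<Rightarrow> ('i \<Rightarrow>\<^sub>0 nat) \<Rightarrow> 'r"
  where "monom_subst f a = (\<Prod>i\<in>Poly_Mapping.keys a. f i ^ Poly_Mapping.lookup a i)"

lemma monom_subst_superset:
  assumes "finite S" "Poly_Mapping.keys a \<subseteq> S"
  shows "monom_subst f a = (\<Prod>i\<in>S. f i ^ Poly_Mapping.lookup a i)"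
  unfolding monom_subst_def
  by (rule prod.mono_neutral_left) (use assms in \<open>auto simp: in_keys_iff\<close>)

lemma monom_subst_add: "monom_subst f (a + b) = monom_subst f a * monom_subst f b"
proof -
  let ?S = "Poly_Mapping.keys a \<union> Poly_Mapping.keys b"
  have "monom_subst f (a + b) = (\<Prod>i\<in>?S. f i ^ Poly_Mapping.lookup (a + b) i)"
    by (rule monom_subst_superset) (use Poly_Mapping.keys_add[of a b] in auto)
  also have "\<dots> = (\<Prod>i\<in>?S. f i ^ Poly_Mapping.lookup a i) * (\<Prod>i\<in>?S. f i ^ Poly_Mapping.lookup b i)"
    by (simp add: lookup_add power_add prod.distrib)
  also have "\<dots> = monom_subst f a * monom_subst f b"
    by (simp add: monom_subst_superset[of ?S])
  finally show ?thesis .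
qed

context
  fixes c :: "'k::comm_ring_1 \<Rightarrow> 'r::comm_ring_1"
  assumes c0: "c 0 = 0" and c1: "c 1 = 1"
    and cadd: "\<And>a b. c (a + b) = c a + c b" and cmult: "\<And>a b. c (a * b) = c a * c b"
begin

lemma poly_subst_superset:
  assumes "finite S" "Poly_Mapping.keys p \<subseteq> S"
  shows "poly_subst c f p = (\<Sum>a\<in>S. c (Poly_Mapping.lookup p a) * monom_subst f a)"
  unfolding poly_subst_def monom_subst_def[symmetric]
  by (rule sum.mono_neutral_left) (use assms in \<open>auto simp: in_keys_iff c0\<close>)

lemma poly_subst_add: "poly_subst c f (p + q) = poly_subst c f p + poly_subst c f q"
proof -
  let ?S = "Poly_Mapping.keys p \<union> Poly_Mapping.keys q"
  have "poly_subst c f (p + q) = (\<Sum>a\<in>?S. c (Poly_Mapping.lookup (p + q) a) * monom_subst f a)"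
    by (rule poly_subst_superset) (use Poly_Mapping.keys_add[of p q] in auto)
  also have "\<dots> = (\<Sum>a\<in>?S. c (Poly_Mapping.lookup p a) * monom_subst f a) +
                  (\<Sum>a\<in>?S. c (Poly_Mapping.lookup q a) * monom_subst f a)"
    by (simp add: lookup_add cadd sum.distrib distrib_right)
  also have "\<dots> = poly_subst c f p + poly_subst c f q"
    by (simp add: poly_subst_superset[of ?S])
  finally show ?thesis .
qed

lemma poly_subst_single: "poly_subst c f (Poly_Mapping.single a k) = c k * monom_subst f a"
  by (simp add: poly_subst_superset[of "{a}"])

lemma poly_subst_const: "poly_subst c f (Poly_Mapping.single 0 k) = c k"
  by (simp add: poly_subst_single monom_subst_def)

lemma poly_subst_indet: "poly_subst c f (indet i) = f i"
  by (simp add: indet_def poly_subst_single c1 monom_subst_def)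

lemma poly_subst_mult:
  fixes f :: "'i \<Rightarrow> 'r"
  shows "poly_subst c f (p * q) = poly_subst c f p * poly_subst c f q"
proof -
  have expand: "p = (\<Sum>a\<in>Poly_Mapping.keys p. Poly_Mapping.single a (Poly_Mapping.lookup p a))"
    for p :: "('i, 'k) mvpoly"
    by (rule poly_mapping_eqI)
      (auto simp: lookup_sum lookup_single when_def in_keys_iff sum.delta')
  have zero: "poly_subst c f 0 = 0" by (simp add: poly_subst_def)
  have sum: "poly_subst c f (sum g A) = (\<Sum>x\<in>A. poly_subst c f (g x))" if "finite A"
    for A and g :: "('i \<Rightarrow>\<^sub>0 nat) \<Rightarrow> ('i, 'k) mvpoly"
    using that by (induction A rule: finite_induct) (simp_all add: zero poly_subst_add)
  have mono: "poly_subst c f (Poly_Mapping.single a k * q) =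
      poly_subst c f (Poly_Mapping.single a k) * poly_subst c f q" for a k
  proof -
    have "poly_subst c f (Poly_Mapping.single a k * q) =
      poly_subst c f (\<Sum>b\<in>Poly_Mapping.keys q.
        Poly_Mapping.single (a + b) (k * Poly_Mapping.lookup q b))"
      by (subst expand[of q]) (simp add: sum_distrib_left mult_single)
    also have "\<dots> = poly_subst c f (Poly_Mapping.single a k) * poly_subst c f q"
      by (simp add: sum poly_subst_single cmult monom_subst_add poly_subst_superset[of "Poly_Mapping.keys q" q]
          sum_distrib_left mult_ac)
    finally show ?thesis .
  qed
  have "poly_subst c f (p * q) =
    poly_subst c f (\<Sum>a\<in>Poly_Mapping.keys p. Poly_Mapping.single a (Poly_Mapping.lookup p a) * q)"
    by (subst expand[of p]) (simp add: sum_distrib_right)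
  also have "\<dots> = (\<Sum>a\<in>Poly_Mapping.keys p. poly_subst c f (Poly_Mapping.single a (Poly_Mapping.lookup p a))) *
      poly_subst c f q"
    by (simp add: sum mono sum_distrib_right)
  also have "\<dots> = poly_subst c f p * poly_subst c f q"
    by (subst (3) expand[of p]) (simp add: sum)
  finally show ?thesis .
qed

end

lemma toric_hom_add: "toric_hom \<gamma> (p + q) = toric_hom \<gamma> p + toric_hom \<gamma> q"
  and toric_hom_mult: "toric_hom \<gamma> (p * q) = toric_hom \<gamma> p * toric_hom \<gamma> q"
  and toric_hom_const: "toric_hom \<gamma> (Poly_Mapping.single 0 k) = Poly_Mapping.single 0 k"
  and toric_hom_indet: "toric_hom \<gamma> (indet i) = laurent_monom (\<gamma> i)"
  unfolding toric_hom_def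
  by (auto intro!: poly_subst_add poly_subst_mult poly_subst_const poly_subst_indet
      simp: single_add mult_single)

lemma unit_vec_lattice: "unit_vec i \<in> int_lattice d \<longleftrightarrow> 1 \<le> i \<and> i \<le> d"
  by (simp add: unit_vec_def int_lattice_def)

lemma generators_lattice:
  assumes "2 \<le> m" "2 \<le> n"
  shows "generators m n \<subseteq> int_lattice (m + n - 1)"
proof -
  have add: "v + w \<in> int_lattice d" if "v \<in> int_lattice d" "w \<in> int_lattice d" for v w d
    using that Poly_Mapping.keys_add[of v w] by (auto simp: int_lattice_def)
  have neg: "- v \<in> int_lattice d" if "v \<in> int_lattice d" for v d
    using that by (simp add: int_lattice_def)
  show ?thesis
    using assms unfolding generators_def
    by (auto simp del: add_uminus_conv_diff uminus_add_conv_diff intro!: add neg simp: unit_vec_lattice)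
qed

lemma bij_betw_generator:
  assumes "2 \<le> m" "2 \<le> n"
  shows "bij_betw (generator m) (positions m n) (generators m n)"
proof -
  have L: "Poly_Mapping.lookup (unit_vec i) k = (if i = k then 1 else 0)" for i k
    by (simp add: unit_vec_def lookup_single when_def)
  have low: "Poly_Mapping.lookup (generator m (i, j)) k = (if i = k \<and> 2 \<le> k then 1 else 0)"
    if "(i, j) \<in> positions m n" "k \<le> m" "2 \<le> k" for i j k
    using that assms by (auto simp: generator_def positions_def lookup_add lookup_minus L)
  have high: "Poly_Mapping.lookup (generator m (i, j)) (m + k - 1) = (if j = k then 1 else 0)"
    if "(i, j) \<in> positions m n" "2 \<le> k" for i j k
    using that assms by (auto simp: generator_def positions_def lookup_add lookup_minus L)
  have "inj_on (generator m) (positions m n)"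
  proof (rule inj_onI, clarify)
    fix i j i' j'
    assume p: "(i, j) \<in> positions m n" and p': "(i', j') \<in> positions m n"
      and eq: "generator m (i, j) = generator m (i', j')"
    have "i = i'"
    proof (rule ccontr)
      assume ne: "i \<noteq> i'"
      have b: "1 \<le> i" "i \<le> m" "1 \<le> i'" "i' \<le> m" using p p' by (auto simp: positions_def)
      then consider "2 \<le> i" | "2 \<le> i'" using ne by linarith
      then show False using low[OF p, of i] low[OF p', of i] low[OF p, of i'] low[OF p', of i'] b ne eq
        by cases auto
    qed
    moreover have "j = j'"
    proof (rule ccontr)
      assume ne: "j \<noteq> j'"
      have b: "1 \<le> j" "1 \<le> j'" using p p' by (auto simp: positions_def)
      then consider "2 \<le> j" | "2 \<le> j'" using ne by linarith
      then show False using high[OF p, of j] high[OF p', of j] high[OF p, of j'] high[OF p', of j'] ne eq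
        by cases auto
    qed
    ultimately show "i = i' \<and> j = j'" ..
  qed
  moreover have "generator m ` positions m n = generators m n"
  proof
    show "generator m ` positions m n \<subseteq> generators m n"
    proof (rule image_subsetI, clarify)
      fix i j assume p: "(i, j) \<in> positions m n"
      then have b: "1 \<le> i" "i \<le> m" "1 \<le> j" "j \<le> n" by (auto simp: positions_def)
      consider "j = 1" | "j \<noteq> 1" "i = 1" | "j \<noteq> 1" "i \<noteq> 1" by blast
      then show "generator m (i, j) \<in> generators m n"
      proof cases
        case 1 then show ?thesis using b by (auto simp: generator_def generators_def)
      next
        case 2
        then have "1 \<le> m + j - 1 \<and> m + j - 1 \<le> m + n - 1" using b by linarith
        with 2 show ?thesis by (auto simp: generator_def generators_def)
      next
        case 3
        then have "2 \<le> i \<and> i \<le> m \<and> 2 \<le> j \<and> j \<le> n" using b by linarith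
        moreover have "generator m (i, j) = - unit_vec 1 + unit_vec i + unit_vec (m + j - 1)"
          using 3 by (simp add: generator_def)
        ultimately show ?thesis unfolding generators_def by blast
      qed
    qed
    show "generators m n \<subseteq> generator m ` positions m n"
    proof
      fix v assume "v \<in> generators m n"
      then consider
          (unit) i where "v = unit_vec i" "1 \<le> i" "i \<le> m + n - 1"
        | (mixed) i j where "v = - unit_vec 1 + unit_vec i + unit_vec (m + j - 1)"
            "2 \<le> i" "i \<le> m" "2 \<le> j" "j \<le> n"
        unfolding generators_def by blast
      then show "v \<in> generator m ` positions m n"
      proof cases
        case (unit i)
        show ?thesis
        proof (cases "i \<le> m")
          case True
          with unit assms show ?thesis
            by (intro image_eqI[of _ _ "(i, 1)"]) (auto simp: generator_def positions_def)
        next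
          case False
          with unit assms show ?thesis
            by (intro image_eqI[of _ _ "(1, i + 1 - m)"]) (auto simp: generator_def positions_def)
        qed
      next
        case (mixed i j)
        then show ?thesis
          by (intro image_eqI[of _ _ "(i, j)"]) (auto simp: generator_def positions_def)
      qed
    qed
  qed
  ultimately show ?thesis by (simp add: bij_betw_def)
qed

end

theory Submission
  imports Defs
begin

text \<open>
  Both varieties consist of the matrices of the form \<open>x\<^sub>i\<^sub>j = u\<^sub>i v\<^sub>j\<close>.

  The exponent of \<open>x\<^sub>i\<^sub>j\<close> is the sum of a vector depending only on \<open>i\<close> and a vector depending
  only on \<open>j\<close> (\<open>generator_split\<close>).  Hence the two terms of a \<open>2\<times>2\<close>-minor are mapped to the same
  Laurent monomial, so the minors lie in the toric ideal, and every point of the toric variety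
  is a zero of the determinantal ideal.

  For the converse, the vanishing of all minors allows the factorization
  \<open>x\<^sub>i\<^sub>j = u\<^sub>i v\<^sub>j\<close> (\<open>rank_one_factorization\<close>): for a nonzero entry \<open>x\<^sub>k\<^sub>l\<close>, take
  \<open>u\<^sub>i = x\<^sub>i\<^sub>l / x\<^sub>k\<^sub>l\<close> and \<open>v\<^sub>j = x\<^sub>k\<^sub>j\<close>.  The value of a monomial with exponent matrix \<open>a\<close> at such a point is
  \<open>\<Prod>u\<^sub>i\<^bsup>r\<^sub>i\<^esup> \<Prod>v\<^sub>j\<^bsup>c\<^sub>j\<^esup>\<close>, where \<open>r\<^sub>i\<close> and \<open>c\<^sub>j\<close> are the row and column sums of \<open>a\<close>.
  These sums are integral linear functions of \<open>\<Sum>a\<^sub>i\<^sub>j \<gamma>\<^sub>i\<^sub>j\<close>, the exponent of the image of the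
  monomial (\<open>margins_of_toric_degree\<close>).  So monomials with the same image take the same value
  at \<open>x\<close>.  If a polynomial lies in the toric ideal, its coefficients sum to zero over each class
  of monomials with the same image, and therefore it vanishes at \<open>x\<close>
  (\<open>toric_variety_memberI\<close>).

  The claim about \<open>\<Gamma>\<close> holds because the vectors matched with the coordinates are exactly the
  given generators (\<open>bij_betw_generator\<close>).
\<close>

section \<open>Evaluation and zero sets\<close>

lemma poly_eval_add: "poly_eval x (p + q) = poly_eval x p + poly_eval x q"
  and poly_eval_mult: "poly_eval x (p * q) = poly_eval x p * poly_eval x q"
  and poly_eval_indet: "poly_eval x (indet i) = x i"
  unfolding poly_eval_def
  by (auto intro!: poly_subst_add poly_subst_mult poly_subst_indet)

lemma poly_eval_diff: "poly_eval x (p - q) = poly_eval x p - poly_eval x q"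
  using poly_eval_add[of x "p - q" q] by simp

lemma poly_eval_monom_subst:
  "poly_eval x p = (\<Sum>a\<in>Poly_Mapping.keys p. Poly_Mapping.lookup p a * monom_subst x a)"
  by (simp add: poly_eval_def poly_subst_def monom_subst_def)

lemma toric_hom_diff: "toric_hom \<gamma> (p - q) = toric_hom \<gamma> p - toric_hom \<gamma> q"
  using toric_hom_add[of \<gamma> "p - q" q] by simp

lemma zero_set_antimono: "J \<subseteq> K \<Longrightarrow> zero_set I K \<subseteq> zero_set I J"
  by (auto simp: zero_set_def)

lemma ideal_vanishing:
  "ideal {p \<in> carrier (poly_ring I). poly_eval x p = (0::'k::comm_ring_1)} (poly_ring I)"
    (is "ideal ?V ?R")
proof -
  interpret cring ?R by (rule cring_poly_ring)
  have eval_0: "poly_eval x 0 = 0"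
    by (simp add: poly_eval_monom_subst)
  have inv: "\<ominus>\<^bsub>?R\<^esub> p = - p" if "p \<in> carrier ?R" for p :: "('a, 'k) mvpoly"
  proof (rule minus_equality)
    show "- p \<oplus>\<^bsub>?R\<^esub> p = \<zero>\<^bsub>?R\<^esub>" by (simp add: poly_ring_def)
    show "- p \<in> carrier ?R" using that by (simp add: poly_ring_def vars_uminus)
  qed (use that in simp)
  show ?thesis
  proof (rule idealI)
    show "subgroup ?V (add_monoid ?R)"
    proof (rule add.subgroupI)
      show "?V \<noteq> {}"
        using zero_closed eval_0 by (auto simp: poly_ring_def)
    next
      fix p assume p: "p \<in> ?V"
      then have "- p \<in> carrier ?R" by (simp add: poly_ring_def vars_uminus)
      moreover have "poly_eval x (- p) = 0"
        using p poly_eval_diff[of x 0 p] eval_0 by simp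
      ultimately show "\<ominus>\<^bsub>?R\<^esub> p \<in> ?V" using p by (simp add: inv)
    next
      fix p q assume "p \<in> ?V" "q \<in> ?V"
      then show "p \<oplus>\<^bsub>?R\<^esub> q \<in> ?V"
        using add.m_closed[of p q] by (simp add: poly_eval_add poly_ring_def)
    qed auto
  next
    fix p q assume "p \<in> ?V" "q \<in> carrier ?R"
    then show "q \<otimes>\<^bsub>?R\<^esub> p \<in> ?V" "p \<otimes>\<^bsub>?R\<^esub> q \<in> ?V"
      using m_closed[of p q] m_closed[of q p] by (simp_all add: poly_eval_mult poly_ring_def)
  qed (rule ring_axioms)
qed

text \<open>
  The polynomials vanishing at a given point form an ideal, so a common zero of \<open>S\<close> is a zero
  of the whole ideal that \<open>S\<close> generates.
\<close>

lemma zero_set_genideal: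
  assumes "S \<subseteq> carrier (poly_ring I)"
  shows "zero_set I (genideal (poly_ring I) S) = zero_set I (S :: ('i, 'k::comm_ring_1) mvpoly set)"
proof
  interpret cring "poly_ring I :: ('i, 'k) mvpoly ring" by (rule cring_poly_ring)
  show "zero_set I (genideal (poly_ring I) S) \<subseteq> zero_set I S"
    by (intro zero_set_antimono genideal_self assms)
  show "zero_set I S \<subseteq> zero_set I (genideal (poly_ring I) S)"
  proof
    fix x assume x: "x \<in> zero_set I S"
    then have "genideal (poly_ring I) S \<subseteq> {p \<in> carrier (poly_ring I). poly_eval x p = 0}"
      using assms by (intro genideal_minimal ideal_vanishing) (auto simp: zero_set_def)
    with x show "x \<in> zero_set I (genideal (poly_ring I) S)"
      by (auto simp: zero_set_def)
  qed
qed

lemma determinantal_variety_two_minors: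
  "determinantal_variety m n = zero_set (positions m n) (two_minors m n)"
  unfolding determinantal_variety_def determinantal_ideal_def
  by (rule zero_set_genideal[OF two_minors_carrier])

section \<open>Toric degrees\<close>

text \<open>The exponent of the Laurent monomial to which the monomial with exponent \<open>a\<close> is mapped.\<close>

definition toric_degree :: "('i \<Rightarrow> nat \<Rightarrow>\<^sub>0 int) \<Rightarrow> ('i \<Rightarrow>\<^sub>0 nat) \<Rightarrow> (nat \<Rightarrow>\<^sub>0 int)"
  where "toric_degree \<gamma> a =
    (\<Sum>i\<in>Poly_Mapping.keys a. frag_cmul (int (Poly_Mapping.lookup a i)) (\<gamma> i))"

lemma lookup_toric_degree:
  "Poly_Mapping.lookup (toric_degree \<gamma> a) k =
    (\<Sum>i\<in>Poly_Mapping.keys a. int (Poly_Mapping.lookup a i) * Poly_Mapping.lookup (\<gamma> i) k)"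
  by (simp add: toric_degree_def lookup_sum)

lemma laurent_monom_mult: "laurent_monom v * laurent_monom w = laurent_monom (v + w)"
  by (simp add: laurent_monom_def mult_single)

lemma laurent_monom_power: "laurent_monom v ^ k = laurent_monom (frag_cmul (int k) v)"
proof (induction k)
  case 0
  then show ?case by (simp add: laurent_monom_def)
next
  case (Suc k)
  have "v + frag_cmul (int k) v = frag_cmul (int (Suc k)) v"
    by (rule poly_mapping_eqI) (simp add: lookup_add algebra_simps)
  then show ?case by (simp add: Suc laurent_monom_mult)
qed

lemma laurent_monom_sum:
  "finite S \<Longrightarrow> (\<Prod>i\<in>S. laurent_monom (g i)) = laurent_monom (\<Sum>i\<in>S. g i)"
proof (induction S rule: finite_induct)
  case empty
  then show ?case by (simp add: laurent_monom_def)
qed (simp add: laurent_monom_mult)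

lemma monom_subst_laurent:
  "monom_subst (\<lambda>i. laurent_monom (\<gamma> i)) a = laurent_monom (toric_degree \<gamma> a)"
  by (simp add: monom_subst_def toric_degree_def laurent_monom_power laurent_monom_sum)

lemma lookup_toric_hom:
  "Poly_Mapping.lookup (toric_hom \<gamma> p) d =
    (\<Sum>a\<in>{a \<in> Poly_Mapping.keys p. toric_degree \<gamma> a = d}. Poly_Mapping.lookup p a)"
proof -
  have "toric_hom \<gamma> p =
      (\<Sum>a\<in>Poly_Mapping.keys p. Poly_Mapping.single (toric_degree \<gamma> a) (Poly_Mapping.lookup p a))"
    unfolding toric_hom_def poly_subst_def monom_subst_def[symmetric] monom_subst_laurent
    by (simp add: laurent_monom_def mult_single)
  then show ?thesis
    by (simp add: lookup_sum lookup_single when_def sum.inter_filter)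
qed

text \<open>
  At a point where monomials of equal degree have equal values, the value of a polynomial is
  a linear combination of its coefficient sums over the degree classes; for an
  element of the toric ideal, these sums are the coefficients of its image, hence zero.
\<close>

lemma toric_variety_memberI:
  fixes x :: "'i \<Rightarrow> 'k::comm_ring_1"
  assumes "x \<in> I \<rightarrow>\<^sub>E UNIV"
    and same_value: "\<And>a b. Poly_Mapping.keys a \<subseteq> I \<Longrightarrow> Poly_Mapping.keys b \<subseteq> I \<Longrightarrow>
      toric_degree \<gamma> a = toric_degree \<gamma> b \<Longrightarrow> monom_subst x a = monom_subst x b"
  shows "x \<in> toric_variety I \<gamma>"
proof -
  have "poly_eval x p = 0" if p: "p \<in> toric_ideal I \<gamma>" for p
  proof -
    let ?K = "Poly_Mapping.keys p"
    let ?D = "\<lambda>d. {a \<in> ?K. toric_degree \<gamma> a = d}"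
    let ?g = "\<lambda>a. Poly_Mapping.lookup p a * monom_subst x a"
    have K: "Poly_Mapping.keys a \<subseteq> I" if "a \<in> ?K" for a
      using p that by (auto simp: toric_ideal_def poly_ring_def vars_def)
    have zero: "sum (Poly_Mapping.lookup p) (?D d) = 0" for d
      using p lookup_toric_hom[of \<gamma> p d] by (simp add: toric_ideal_def)
    have "sum ?g (?D d) = 0" if "d \<in> toric_degree \<gamma> ` ?K" for d
    proof -
      from that obtain b where b: "b \<in> ?D d" by auto
      have "sum ?g (?D d) = (\<Sum>a\<in>?D d. Poly_Mapping.lookup p a * monom_subst x b)"
      proof (rule sum.cong[OF refl])
        fix a assume "a \<in> ?D d"
        then have "monom_subst x a = monom_subst x b"
          using b by (intro same_value K) auto
        then show "?g a = Poly_Mapping.lookup p a * monom_subst x b" by simp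
      qed
      also have "\<dots> = 0" by (simp add: zero flip: sum_distrib_right)
      finally show ?thesis .
    qed
    moreover have "poly_eval x p = (\<Sum>d\<in>toric_degree \<gamma> ` ?K. sum ?g (?D d))"
      by (simp add: poly_eval_monom_subst flip: sum.image_gen)
    ultimately show ?thesis by simp
  qed
  with assms(1) show ?thesis by (simp add: toric_variety_def zero_set_def)
qed

section \<open>The minors lie in the toric ideal\<close>

lemma generator_split:
  "generator m (i, j) = unit_vec i + (if j = 1 then 0 else unit_vec (m + j - 1) - unit_vec 1)"
  by (auto simp: generator_def)

text \<open>
  By \<open>generator_split\<close>, exchanging the column indices of two generators does not change
  their sum.
\<close>

lemma two_minors_subset_toric_ideal:
  "two_minors m n \<subseteq> toric_ideal (positions m n) (generator m)"
proof
  fix p :: "(nat \<times> nat, 'k::comm_ring_1) mvpoly" assume p: "p \<in> two_minors m n"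
  then obtain i j k l where
    "p = indet (i, j) * indet (k, l) - indet (i, l) * indet (k, j)"
    by (auto simp: two_minors_def)
  moreover have "generator m (i, j) + generator m (k, l) = generator m (i, l) + generator m (k, j)"
    by (simp only: generator_split ac_simps)
  ultimately have "toric_hom (generator m) p = 0"
    by (simp add: toric_hom_diff toric_hom_mult toric_hom_indet laurent_monom_mult)
  with p two_minors_carrier show "p \<in> toric_ideal (positions m n) (generator m)"
    by (auto simp: toric_ideal_def)
qed

section \<open>Matrices of rank less than two\<close>

text \<open>
  Exchanging two rows or two columns only changes the sign of a minor, and a minor with a
  repeated row or column is zero, so the relation holds without any order on the indices.
\<close>

lemma vanishing_minors:
  fixes x :: "nat \<times> nat \<Rightarrow> 'k::comm_ring_1"
  assumes x: "x \<in> zero_set (positions m n) (two_minors m n)"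
    and "(i, j) \<in> positions m n" "(k, l) \<in> positions m n"
  shows "x (i, j) * x (k, l) = x (i, l) * x (k, j)"
proof -
  have ordered: "x (i, j) * x (k, l) = x (i, l) * x (k, j)"
    if "1 \<le> i" "i < k" "k \<le> m" "1 \<le> j" "j < l" "l \<le> n" for i j k l
  proof -
    have "indet (i, j) * indet (k, l) - indet (i, l) * indet (k, j) \<in>
        (two_minors m n :: (nat \<times> nat, 'k) mvpoly set)"
      unfolding two_minors_def using that by blast
    with x have "poly_eval x (indet (i, j) * indet (k, l) - indet (i, l) * indet (k, j)) = 0"
      unfolding zero_set_def by blast
    then show ?thesis by (simp add: poly_eval_diff poly_eval_mult poly_eval_indet)
  qed
  consider "i = k" | "j = l" | "i < k" "j < l" | "i < k" "l < j" | "k < i" "j < l" | "k < i" "l < j"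
    by linarith
  then show ?thesis
    using assms(2,3) ordered[of i k j l] ordered[of i k l j] ordered[of k i j l] ordered[of k i l j]
    by cases (auto simp: positions_def mult.commute)
qed

lemma rank_one_factorization:
  fixes x :: "nat \<times> nat \<Rightarrow> 'k::field"
  assumes x: "x \<in> zero_set (positions m n) (two_minors m n)"
  obtains u v where "\<And>i j. (i, j) \<in> positions m n \<Longrightarrow> x (i, j) = u i * v j"
proof (cases "\<forall>q\<in>positions m n. x q = 0")
  case True
  then show ?thesis using that[of "\<lambda>_. 0" "\<lambda>_. 0"] by auto
next
  case False
  then obtain k l where kl: "(k, l) \<in> positions m n" "x (k, l) \<noteq> 0" by auto
  show ?thesis
  proof (rule that)
    fix i j assume "(i, j) \<in> positions m n"
    from vanishing_minors[OF x this kl(1)] kl(2)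
    show "x (i, j) = (x (i, l) / x (k, l)) * x (k, j)"
      by (simp add: field_simps)
  qed
qed

section \<open>Row and column sums\<close>

text \<open>
  For the exponent of a monomial in the entries of a matrix, \<open>f = fst\<close> gives the row sums and
  \<open>f = snd\<close> the column sums; abstracting \<open>f\<close> treats both at once.
\<close>

definition margin :: "('i \<Rightarrow> 'r) \<Rightarrow> ('i \<Rightarrow>\<^sub>0 nat) \<Rightarrow> 'r \<Rightarrow> nat"
  where "margin f a r =
    (\<Sum>q\<in>{q \<in> Poly_Mapping.keys a. f q = r}. Poly_Mapping.lookup a q)"

lemma int_margin:
  "int (margin f a r) =
    (\<Sum>q\<in>Poly_Mapping.keys a. int (Poly_Mapping.lookup a q) * (if f q = r then 1 else 0))"
  by (simp add: margin_def sum.inter_filter if_distrib cong: if_cong)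

lemma prod_power_margin:
  assumes "finite R" and "f ` Poly_Mapping.keys a \<subseteq> R"
  shows "(\<Prod>q\<in>Poly_Mapping.keys a. u (f q) ^ Poly_Mapping.lookup a q) =
    (\<Prod>r\<in>R. u r ^ margin f a r)"
proof -
  have "(\<Prod>q\<in>Poly_Mapping.keys a. u (f q) ^ Poly_Mapping.lookup a q) =
    (\<Prod>r\<in>R. \<Prod>q\<in>{q \<in> Poly_Mapping.keys a. f q = r}. u (f q) ^ Poly_Mapping.lookup a q)"
    by (rule prod.group[symmetric]) (use assms in auto)
  also have "\<dots> = (\<Prod>r\<in>R. u r ^ margin f a r)"
    by (simp add: margin_def power_sum)
  finally show ?thesis .
qed

lemma monom_subst_rank_one:
  assumes a: "Poly_Mapping.keys a \<subseteq> positions m n"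
    and x: "\<And>i j. (i, j) \<in> positions m n \<Longrightarrow> x (i, j) = u i * v j"
  shows "monom_subst x a =
    (\<Prod>i\<in>{1..m}. u i ^ margin fst a i) * (\<Prod>j\<in>{1..n}. v j ^ margin snd a j)"
proof -
  have "monom_subst x a = (\<Prod>q\<in>Poly_Mapping.keys a.
      u (fst q) ^ Poly_Mapping.lookup a q * v (snd q) ^ Poly_Mapping.lookup a q)"
    unfolding monom_subst_def
    by (rule prod.cong) (use a x in \<open>force simp: power_mult_distrib\<close>)+
  also have "\<dots> = (\<Prod>i\<in>{1..m}. u i ^ margin fst a i) * (\<Prod>j\<in>{1..n}. v j ^ margin snd a j)"
    unfolding prod.distrib
    by (intro arg_cong2[where f = "(*)"] prod_power_margin)
      (use a in \<open>auto simp: positions_def\<close>)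
  finally show ?thesis .
qed

text \<open>
  The first coordinate of \<open>\<gamma>\<^sub>i\<^sub>j\<close> is \<open>1 - [i \<ge> 2] - [j \<ge> 2]\<close>, and the others are the indicators
  \<open>[i = k]\<close> and \<open>[j = k]\<close> for \<open>k \<ge> 2\<close>.  So the first row sum, which counts \<open>1 - [i \<ge> 2]\<close>, is
  obtained from the first coordinate by adding the column sums for \<open>j \<ge> 2\<close>, and
  symmetrically for the first column sum.
\<close>

lemma margins_of_toric_degree:
  assumes a: "Poly_Mapping.keys a \<subseteq> positions m n"
  defines "d \<equiv> Poly_Mapping.lookup (toric_degree (generator m) a)"
  shows "\<lbrakk>2 \<le> k; k \<le> m\<rbrakk> \<Longrightarrow> int (margin fst a k) = d k"
    and "2 \<le> k \<Longrightarrow> int (margin snd a k) = d (m + k - 1)"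
    and "int (margin fst a 1) = d 1 + (\<Sum>k\<in>{2..n}. int (margin snd a k))"
    and "int (margin snd a 1) = d 1 + (\<Sum>k\<in>{2..m}. int (margin fst a k))"
proof -
  have L: "Poly_Mapping.lookup (unit_vec i) k = (if i = k then 1 else 0)" for i k
    by (simp add: unit_vec_def lookup_single when_def)
  have bounds: "1 \<le> fst q" "fst q \<le> m" "1 \<le> snd q" "snd q \<le> n"
    if "q \<in> Poly_Mapping.keys a" for q
    using a that by (auto simp: positions_def)
  note G = lookup_add lookup_minus L generator_split
  show "int (margin fst a k) = d k" if "2 \<le> k" "k \<le> m"
    unfolding int_margin d_def lookup_toric_degree
  proof (rule sum.cong[OF refl])
    fix q assume "q \<in> Poly_Mapping.keys a"
    from bounds[OF this] that
    show "int (Poly_Mapping.lookup a q) * (if fst q = k then 1 else 0) =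
      int (Poly_Mapping.lookup a q) * Poly_Mapping.lookup (generator m q) k"
      by (cases q) (auto simp: G)
  qed
  show "int (margin snd a k) = d (m + k - 1)" if "2 \<le> k"
    unfolding int_margin d_def lookup_toric_degree
  proof (rule sum.cong[OF refl])
    fix q assume "q \<in> Poly_Mapping.keys a"
    from bounds[OF this] that
    show "int (Poly_Mapping.lookup a q) * (if snd q = k then 1 else 0) =
      int (Poly_Mapping.lookup a q) * Poly_Mapping.lookup (generator m q) (m + k - 1)"
      by (cases q) (auto simp: G)
  qed
  have tail: "(\<Sum>k\<in>{2..N}. int (margin f a k)) =
      (\<Sum>q\<in>Poly_Mapping.keys a. int (Poly_Mapping.lookup a q) * (if 2 \<le> f q then 1 else 0))"
    if "\<And>q. q \<in> Poly_Mapping.keys a \<Longrightarrow> f q \<le> N" for f :: "nat \<times> nat \<Rightarrow> nat" and N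
    unfolding int_margin using that
    by (subst sum.swap) (auto simp flip: sum_distrib_left intro!: sum.cong)
  have tail_fst: "(\<Sum>k\<in>{2..m}. int (margin fst a k)) =
      (\<Sum>q\<in>Poly_Mapping.keys a. int (Poly_Mapping.lookup a q) * (if 2 \<le> fst q then 1 else 0))"
    by (rule tail) (rule bounds)
  have tail_snd: "(\<Sum>k\<in>{2..n}. int (margin snd a k)) =
      (\<Sum>q\<in>Poly_Mapping.keys a. int (Poly_Mapping.lookup a q) * (if 2 \<le> snd q then 1 else 0))"
    by (rule tail) (rule bounds)
  show "int (margin fst a 1) = d 1 + (\<Sum>k\<in>{2..n}. int (margin snd a k))"
    unfolding tail_snd unfolding int_margin d_def
      lookup_toric_degree sum.distrib[symmetric] distrib_left[symmetric]
  proof (rule sum.cong[OF refl])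
    fix q assume "q \<in> Poly_Mapping.keys a"
    from bounds[OF this]
    show "int (Poly_Mapping.lookup a q) * (if fst q = 1 then 1 else 0) =
      int (Poly_Mapping.lookup a q) *
        (Poly_Mapping.lookup (generator m q) 1 + (if 2 \<le> snd q then 1 else 0))"
      by (cases q) (auto simp: G)
  qed
  show "int (margin snd a 1) = d 1 + (\<Sum>k\<in>{2..m}. int (margin fst a k))"
    unfolding tail_fst unfolding int_margin d_def
      lookup_toric_degree sum.distrib[symmetric] distrib_left[symmetric]
  proof (rule sum.cong[OF refl])
    fix q assume "q \<in> Poly_Mapping.keys a"
    from bounds[OF this]
    show "int (Poly_Mapping.lookup a q) * (if snd q = 1 then 1 else 0) =
      int (Poly_Mapping.lookup a q) *
        (Poly_Mapping.lookup (generator m q) 1 + (if 2 \<le> fst q then 1 else 0))"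
      by (cases q) (auto simp: G)
  qed
qed

lemma margins_eq_of_toric_degree_eq:
  assumes a: "Poly_Mapping.keys a \<subseteq> positions m n" and b: "Poly_Mapping.keys b \<subseteq> positions m n"
    and eq: "toric_degree (generator m) a = toric_degree (generator m) b"
  shows "i \<in> {1..m} \<Longrightarrow> margin fst a i = margin fst b i"
    and "j \<in> {1..n} \<Longrightarrow> margin snd a j = margin snd b j"
proof -
  note A = margins_of_toric_degree[OF a] and B = margins_of_toric_degree[OF b]
  have row: "int (margin fst a k) = int (margin fst b k)" if "2 \<le> k" "k \<le> m" for k
    using A(1)[OF that] B(1)[OF that] eq by simp
  have col: "int (margin snd a k) = int (margin snd b k)" if "2 \<le> k" for k
    using A(2)[OF that] B(2)[OF that] eq by simp
  have "int (margin fst a 1) = int (margin fst b 1)"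
    unfolding A(3) B(3) eq by (simp add: col)
  with row[of i] show "margin fst a i = margin fst b i" if "i \<in> {1..m}"
    using that by (cases "i = 1") auto
  have "int (margin snd a 1) = int (margin snd b 1)"
    unfolding A(4) B(4) eq by (simp add: row)
  with col[of j] show "margin snd a j = margin snd b j" if "j \<in> {1..n}"
    using that by (cases "j = 1") auto
qed

section \<open>Equality of the two varieties\<close>

theorem theorem1:
  fixes m n :: nat and \<Gamma> :: "(nat \<Rightarrow>\<^sub>0 int) set"
  assumes "2 \<le> m" and "2 \<le> n"
    and "\<Gamma> = semigroup_generated (generators m n)"
  shows "\<Gamma> = semigroup_generated (generator m ` positions m n) \<and>
    (determinantal_variety m n :: (nat \<times> nat \<Rightarrow> 'k::alg_closed_field) set) =
      toric_variety (positions m n) (generator m)"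
proof (intro conjI subset_antisym)
  have "generator m ` positions m n = generators m n"
    using bij_betw_generator[OF assms(1,2)] by (simp add: bij_betw_def)
  then show "\<Gamma> \<subseteq> semigroup_generated (generator m ` positions m n)"
    "semigroup_generated (generator m ` positions m n) \<subseteq> \<Gamma>"
    by (simp_all add: assms(3))
next
  show "toric_variety (positions m n) (generator m) \<subseteq>
      (determinantal_variety m n :: (nat \<times> nat \<Rightarrow> 'k) set)"
    unfolding determinantal_variety_two_minors toric_variety_def
    by (rule zero_set_antimono[OF two_minors_subset_toric_ideal])
next
  show "(determinantal_variety m n :: (nat \<times> nat \<Rightarrow> 'k) set) \<subseteq>
      toric_variety (positions m n) (generator m)"
  proof
    fix x :: "nat \<times> nat \<Rightarrow> 'k" assume "x \<in> determinantal_variety m n"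
    then have x: "x \<in> zero_set (positions m n) (two_minors m n)"
      by (simp add: determinantal_variety_two_minors)
    obtain u v where uv: "\<And>i j. (i, j) \<in> positions m n \<Longrightarrow> x (i, j) = u i * v j"
      using rank_one_factorization[OF x] by blast
    have value_uv: "monom_subst x a =
        (\<Prod>i\<in>{1..m}. u i ^ margin fst a i) * (\<Prod>j\<in>{1..n}. v j ^ margin snd a j)"
      if "Poly_Mapping.keys a \<subseteq> positions m n" for a
      by (rule monom_subst_rank_one) (use that uv in auto)
    show "x \<in> toric_variety (positions m n) (generator m)"
    proof (rule toric_variety_memberI)
      show "x \<in> positions m n \<rightarrow>\<^sub>E UNIV"
        using x by (simp add: zero_set_def)
    next
      fix a b
      assume a: "Poly_Mapping.keys a \<subseteq> positions m n" and b: "Poly_Mapping.keys b \<subseteq> positions m n"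
        and eq: "toric_degree (generator m) a = toric_degree (generator m) b"
      show "monom_subst x a = monom_subst x b"
        using margins_eq_of_toric_degree_eq[OF a b eq]
        by (simp add: value_uv[OF a] value_uv[OF b])
    qed
  qed
qed

end
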